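(* Let $T\ge 1$, let $A\in\mathbb{R}^{n\times n}$, $B\in\mathbb{R}^{n\times m}$, the Markov process $(s_t)$ on $\mathcal{S}\subset\mathbb{R}^p$ with transition kernels $\mathbb{P}_t(s'|s)=\phi(s)^{\mathsf T}\mu_t(s')$, and the quadratic cost $c$ with weight blocks $W,F,D,M,H,R$ be as described in the context (in particular, the Linear Markov Process assumption and the Quadratic Cost assumption hold). Let $Q_t^*$ be the optimal state-action value function. Then for each $t\in\{0,\dots,T-1\}$ there exist vectors $\overline{h}_{i,t+1}\in\mathbb{R}^n$ and scalars $\overline{q}_{i,t+1}\in\mathbb{R}$, $i=1,\dots,d$, such that for all $x\in\mathbb{R}^n$, $s\in\mathcal{S}$, $u\in\mathbb{R}^m$, $$Q_t^*(x,s,u)=c(x,s,u)+(Ax+Bu)^{\mathsf T}G_{t+1}(Ax+Bu)+\sum_{i=1}^d\phi_i(s)\Big(2(Ax+Bu)^{\mathsf T}\overline{h}_{i,t+1}+\overline{q}_{i,t+1}\Big),$$ where $G$ solves the backward Riccati recursion $$G_t=A^{\mathsf T}G_{t+1}A+W-(A^{\mathsf T}G_{t+1}B+D)(R+B^{\mathsf T}G_{t+1}B)^{-1}(B^{\mathsf T}G_{t+1}A+D^{\mathsf T}),\qquad G_T=W.$$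
   Context: System: $x_{t+1}=Ax_t+Bu_t$ for $t\in\{0,\dots,T-1\}$, with state $x_t\in\mathcal X=\mathbb{R}^n$, input $u_t\in\mathcal U=\mathbb{R}^m$, $x_0\sim\mathcal N(0,\Sigma_x)$, $\Sigma_x\succ0$, and $(A,B)$ controllable. Environment: a Markov process with $s_{t+1}|s_t\sim\mathbb{P}_t(\cdot|s_t)$, $s_t\in\mathcal S\subset\mathbb{R}^p$, $s_0\sim\mu_0$ (a probability distribution on $\mathcal S$); it is not affected by $x_t$ or $u_t$. Linear Markov Process assumption: there are a map $\phi:\mathcal S\to\mathbb{R}^d$ and vectors $\mu_t=(\mu_{1,t},\dots,\mu_{d,t})$ of $d$ (finite) signed measures on $\mathcal S$ with $\mathbb{P}_t(s'|s)=\phi(s)^{\mathsf T}\mu_t(s')$, i.e. $\mathbb{P}_t(\mathrm{d}s'|s)=\sum_{i=1}^d\phi_i(s)\mu_{i,t}(\mathrm{d}s')$. Moreover $\|\phi(s)\|\le1/\sqrt d$ and $\|s\|\le\delta_s$ for all $s\in\mathcal S$, and $\mathbb{E}[\phi(s_t)\phi(s_t)^{\mathsf T}]\succ0$ for all $t$. All maps are measurable. Quadratic Cost assumption: $$c(x,s,u)=\begin{bmatrix} x \\ s \\ u \end{bmatrix}^{\mathsf T}P\begin{bmatrix} x \\ s \\ u \end{bmatrix},\quad P=\begin{bmatrix} W & F & D \\ F^{\mathsf T} & M & H \\ D^{\mathsf T} & H^{\mathsf T} & R \end{bmatrix}\succeq0,\quad R\succ0,$$ and $(A,W^{1/2})$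 is observable. Control problem: minimize $\mathbb{E}[\sum_{t=0}^Tc(x_t,s_t,u_t)]$ over deterministic policies $u_t=\pi_t(x_t,s_t)$, with the convention $u_T=\pi_T(x_T,s_T)=0$. The optimal value functions $V_t^*$ and state-action value functions $Q_t^*$ satisfy the Bellman optimality recursion $V_T^*(x,s)=c(x,s,0)$ and, for $t\in\{0,\dots,T-1\}$, $Q_t^*(x,s,u)=c(x,s,u)+\mathbb{E}_{s'\sim\mathbb{P}_t(\cdot|s)}[V_{t+1}^*(Ax+Bu,s')]$, $V_t^*(x,s)=\min_uQ_t^*(x,s,u)$. *)

theory Defs
  imports "HOL-Probability.Probability"
begin

definition pos_semidef :: "real^'n^'n \<Rightarrow> bool" where
  "pos_semidef A \<longleftrightarrow> transpose A = A \<and> (\<forall>x. 0 \<le> x \<bullet> (A *v x))"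

definition pos_def :: "real^'n^'n \<Rightarrow> bool" where
  "pos_def A \<longleftrightarrow> transpose A = A \<and> (\<forall>x. x \<noteq> 0 \<longrightarrow> 0 < x \<bullet> (A *v x))"

definition mat_sqrt :: "real^'n^'n \<Rightarrow> real^'n^'n" where
  "mat_sqrt A = (THE S. pos_semidef S \<and> S ** S = A)"

text \<open>Kalman rank conditions: the blocks \<open>A\<^sup>k B\<close> (resp. \<open>C A\<^sup>k\<close>) with \<open>k < n\<close>, placed side by
  side (resp. stacked), form a matrix of rank \<open>n\<close>. The powers are iterated matrix products,
  because \<open>(^)\<close> on the vector type is componentwise.\<close>

definition controllable :: "real^'n^'n \<Rightarrow> real^'m^'n \<Rightarrow> bool" where
  "controllable A B \<longleftrightarrow> span (\<Union>k<CARD('n). columns (((\<lambda>X. A ** X) ^^ k) B)) = UNIV"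

definition observable :: "real^'n^'n \<Rightarrow> real^'n^'k \<Rightarrow> bool" where
  "observable A C \<longleftrightarrow> span (\<Union>k<CARD('n). rows (((\<lambda>X. X ** A) ^^ k) C)) = UNIV"

definition gaussian_density :: "real^'n^'n \<Rightarrow> real^'n \<Rightarrow> real" where
  "gaussian_density \<Sigma> x =
     exp (- (x \<bullet> (matrix_inv \<Sigma> *v x)) / 2) / sqrt ((2 * pi) ^ CARD('n) * det \<Sigma>)"

definition stack :: "real^'n \<Rightarrow> real^'p \<Rightarrow> real^'m \<Rightarrow> real^('n + 'p + 'm)" where
  "stack x s u = (\<chi> i. case i of Inl a \<Rightarrow> x $ a
                              | Inr (Inl b) \<Rightarrow> s $ b
                              | Inr (Inr c) \<Rightarrow> u $ c)"

definition cost_matrix ::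
  "real^'n^'n \<Rightarrow> real^'p^'n \<Rightarrow> real^'m^'n \<Rightarrow> real^'p^'p \<Rightarrow> real^'m^'p \<Rightarrow> real^'m^'m
     \<Rightarrow> real^('n + 'p + 'm)^('n + 'p + 'm)" where
  "cost_matrix W F D M H R = (\<chi> i. case i of
       Inl a \<Rightarrow> stack (W $ a) (F $ a) (D $ a)
     | Inr (Inl b) \<Rightarrow> stack (transpose F $ b) (M $ b) (H $ b)
     | Inr (Inr c) \<Rightarrow> stack (transpose D $ c) (transpose H $ c) (R $ c))"

definition quad_cost ::
  "real^('n + 'p + 'm)^('n + 'p + 'm) \<Rightarrow> real^'n \<Rightarrow> real^'p \<Rightarrow> real^'m \<Rightarrow> real" where
  "quad_cost P x s u = stack x s u \<bullet> (P *v stack x s u)"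

text \<open>Finite signed measures are real-valued countably additive set functions.\<close>

definition finite_signed_measure :: "'a measure \<Rightarrow> ('a set \<Rightarrow> real) \<Rightarrow> bool" where
  "finite_signed_measure N \<nu> \<longleftrightarrow> \<nu> {} = 0 \<and>
     (\<forall>E :: nat \<Rightarrow> 'a set. range E \<subseteq> sets N \<longrightarrow> disjoint_family E \<longrightarrow>
        (\<lambda>i. \<nu> (E i)) sums \<nu> (\<Union>i. E i))"

text \<open>The environment states \<open>\<xi>\<^sub>0, \<dots>, \<xi>\<^sub>T\<close> have values in \<open>N\<close>, initial law \<open>\<mu>0\<close> and transition
  kernels \<open>K t\<close>. Under deterministic policies every system state and input up to time \<open>t\<close> is a
  function of \<open>x\<^sub>0, \<xi>\<^sub>0, \<dots>, \<xi>\<^sub>t\<close>, so conditioning on a history that includes \<open>x\<^sub>0\<close> expresses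
  that the system does not affect the environment.\<close>

definition history ::
  "'w measure \<Rightarrow> 'a measure \<Rightarrow> ('w \<Rightarrow> real^'n) \<Rightarrow> (nat \<Rightarrow> 'w \<Rightarrow> 'a) \<Rightarrow> nat \<Rightarrow> 'w measure" where
  "history \<Omega> N x0 \<xi> t = sigma (space \<Omega>)
     ({x0 -` E \<inter> space \<Omega> | E. E \<in> sets borel} \<union>
      {\<xi> i -` E \<inter> space \<Omega> | i E. i \<le> t \<and> E \<in> sets N})"

definition markov_environment ::
  "'w measure \<Rightarrow> 'a measure \<Rightarrow> ('w \<Rightarrow> real^'n) \<Rightarrow> 'a measure \<Rightarrow> (nat \<Rightarrow> 'a \<Rightarrow> 'a measure) \<Rightarrow> nat
     \<Rightarrow> (nat \<Rightarrow> 'w \<Rightarrow> 'a) \<Rightarrow> bool" where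
  "markov_environment \<Omega> N x0 \<mu>0 K T \<xi> \<longleftrightarrow>
     (\<forall>t<T. K t \<in> measurable N (prob_algebra N)) \<and>
     (\<forall>t\<le>T. \<xi> t \<in> measurable \<Omega> N) \<and>
     distr \<Omega> N (\<xi> 0) = \<mu>0 \<and>
     (\<forall>t<T. \<forall>E\<in>sets N. AE w in \<Omega>.
        real_cond_exp \<Omega> (history \<Omega> N x0 \<xi> t) (indicator (\<xi> (Suc t) -` E \<inter> space \<Omega>)) w
          = measure (K t (\<xi> t w)) E)"

text \<open>The optimal value functions of the finite-horizon problem, defined by the Bellman optimality
  recursion; the terminal input is \<open>0\<close>.\<close>

function opt_V ::
  "(real^'n \<Rightarrow> 'a \<Rightarrow> real^'m \<Rightarrow> real) \<Rightarrow> real^'n^'n \<Rightarrow> real^'m^'n \<Rightarrow> (nat \<Rightarrow> 'a \<Rightarrow> 'a measure) \<Rightarrow> nat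
     \<Rightarrow> nat \<Rightarrow> real^'n \<Rightarrow> 'a \<Rightarrow> real" where
  "opt_V c A B K T t x s =
     (if T \<le> t then c x s 0
      else INF u. c x s u + integral\<^sup>L (K t s) (\<lambda>s'. opt_V c A B K T (Suc t) (A *v x + B *v u) s'))"
  by pat_completeness auto
termination
  by (relation "Wellfounded.measure (\<lambda>(c, A, B, K, T, t, x, s). T - t)") auto

declare opt_V.simps [simp del]

definition opt_Q ::
  "(real^'n \<Rightarrow> 'a \<Rightarrow> real^'m \<Rightarrow> real) \<Rightarrow> real^'n^'n \<Rightarrow> real^'m^'n \<Rightarrow> (nat \<Rightarrow> 'a \<Rightarrow> 'a measure) \<Rightarrow> nat
     \<Rightarrow> nat \<Rightarrow> real^'n \<Rightarrow> 'a \<Rightarrow> real^'m \<Rightarrow> real" where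
  "opt_Q c A B K T t x s u =
     c x s u + integral\<^sup>L (K t s) (\<lambda>s'. opt_V c A B K T (Suc t) (A *v x + B *v u) s')"

lemma opt_V_terminal: "opt_V c A B K T T x s = c x s 0"
  by (simp add: opt_V.simps)

lemma opt_V_step: "t < T \<Longrightarrow> opt_V c A B K T t x s = (INF u. opt_Q c A B K T t x s u)"
  by (subst opt_V.simps) (simp add: opt_Q_def)

end

theory Submission
  imports Defs
begin

text \<open>
  The value functions keep one shape under the backward Bellman recursion: for \<open>s \<in> S\<close>,
  \<open>V\<^sub>t(x, s) = x \<bullet> G\<^sub>t x + 2 x \<bullet> h(s, \<phi> s) + q(s, \<phi> s)\<close> with \<open>G\<^sub>t\<close> positive semidefinite and
  \<open>h\<close>, \<open>q\<close> continuous on the whole space. Two facts drive the induction.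

  Taking expectations. Integrating against the kernel leaves the purely quadratic term alone and
  turns each bounded measurable function of \<open>s'\<close> into a linear function of \<open>\<phi> s\<close>
  (lemmas \<open>linear_kernel_integral\<close> and \<open>expected_value\<close>). Integration against the signed measures
  can be bypassed: if \<open>\<phi> s = \<Sum>\<^sub>v c\<^sub>v \<phi>(s\<^sub>v)\<close>, where the \<open>\<phi>(s\<^sub>v)\<close> form a basis of the span of
  \<open>\<phi>(S)\<close>, then \<open>K(s) = \<Sum>\<^sub>v c\<^sub>v K(s\<^sub>v)\<close> on every measurable set, so the same identity holds for
  integrals of bounded functions, and \<open>c\<close> depends linearly on \<open>\<phi> s\<close>. This gives the claimed form
  of \<open>Q\<^sub>t\<close>.

  Minimising over the input. With this form \<open>Q\<^sub>t\<close> is, in \<open>u\<close>, a quadratic with Hessian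
  \<open>2 (R + B\<^sup>T G B)\<close>, positive definite because \<open>R\<close> is and \<open>G\<close> is semidefinite. Completing the
  square (lemma \<open>bellman_quadratic\<close>) gives the Riccati matrix as the new quadratic part, while the
  other coefficients are continuous in \<open>s\<close> and \<open>\<phi> s\<close>. The Riccati matrix is again semidefinite: it
  is the minimum of a nonnegative cost, namely the case \<open>s = 0\<close> without noise terms
  (lemma \<open>pos_semidef_riccati_map\<close>).

  Continuity is the convenient bookkeeping device: \<open>S\<close> and \<open>\<phi>(S)\<close> are bounded, so a continuous
  function of \<open>(s, \<phi> s)\<close> is automatically bounded and measurable on \<open>S\<close>.
\<close>


section \<open>Transposes and block matrices\<close>

text \<open>The default rewriting of \<open>transpose X *v x\<close> to \<open>x v* X\<close> would hide the transposes that the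
  two adjointness lemmas below move across inner products.\<close>

declare transpose_matrix_vector [simp del]

lemma inner_transpose_left: "(transpose X *v x) \<bullet> y = x \<bullet> (X *v y)"
  for X :: "real^'a^'b"
  by (metis dot_lmul_matrix transpose_matrix_vector)

lemma inner_transpose_right: "x \<bullet> (transpose X *v y) = (X *v x) \<bullet> y"
  for X :: "real^'a^'b"
  by (metis inner_commute inner_transpose_left)

lemma transpose_add: "transpose (X + Y) = transpose X + transpose Y"
  and transpose_diff: "transpose (X - Y) = transpose X - transpose Y" for X Y :: "real^'a^'b"
  by (simp_all add: transpose_def vec_eq_iff)

lemma sum_UNIV_Plus:
  "(\<Sum>i\<in>UNIV. f i) = (\<Sum>a\<in>UNIV. f (Inl a)) + (\<Sum>b\<in>UNIV. f (Inr b))"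
  for f :: "'a::finite + 'b::finite \<Rightarrow> real"
  by (simp add: UNIV_Plus_UNIV[symmetric] sum.Plus del: UNIV_Plus_UNIV)

lemma inner_stack: "stack x s u \<bullet> stack x' s' u' = x \<bullet> x' + s \<bullet> s' + u \<bullet> u'"
  by (simp add: inner_vec_def sum_UNIV_Plus stack_def)

lemma cost_matrix_mult_stack:
  "cost_matrix W F D M H R *v stack x s u =
     stack (W *v x + F *v s + D *v u)
           (transpose F *v x + M *v s + H *v u)
           (transpose D *v x + transpose H *v s + R *v u)"
proof -
  have row: "(cost_matrix W F D M H R *v stack x s u) $ i = cost_matrix W F D M H R $ i \<bullet> stack x s u" for i
    by (simp add: matrix_vector_mult_def inner_vec_def)
  have component: "(X *v y) $ a = X $ a \<bullet> y" for X :: "real^'i^'j" and y a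
    by (simp add: matrix_vector_mult_def inner_vec_def)
  show ?thesis
    unfolding vec_eq_iff row
    by (auto simp: cost_matrix_def inner_stack component split: sum.split) (auto simp: stack_def component)
qed

lemma quad_cost_cost_matrix:
  assumes W: "transpose W = W"
  shows "quad_cost (cost_matrix W F D M H R) x s u =
    x \<bullet> (W *v x) + s \<bullet> (M *v s) + u \<bullet> (R *v u)
    + 2 * (x \<bullet> (F *v s)) + 2 * (x \<bullet> (D *v u)) + 2 * (s \<bullet> (H *v u))"
  unfolding quad_cost_def cost_matrix_mult_stack inner_stack
  by (simp add: inner_add_right inner_transpose_right
      inner_commute[of s "transpose F *v x"] inner_commute[of u "transpose D *v x"]
      inner_commute[of u "transpose H *v s"] inner_transpose_left
      inner_commute[of x "F *v s"] inner_commute[of x "D *v u"] inner_commute[of s "H *v u"])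

text \<open>Test vectors supported in the state block suffice; this starts the induction at \<open>G\<^sub>T = W\<close>.\<close>

lemma pos_semidef_upper_left:
  assumes "pos_semidef (cost_matrix W F D M H R)"
  shows "pos_semidef W"
proof -
  let ?P = "cost_matrix W F D M H R"
  have "W $ i $ j = W $ j $ i" for i j
  proof -
    have "transpose ?P $ Inl i $ Inl j = ?P $ Inl i $ Inl j"
      using assms by (simp add: pos_semidef_def)
    then show ?thesis
      by (simp add: transpose_def cost_matrix_def stack_def)
  qed
  then have sym: "transpose W = W"
    by (simp add: transpose_def vec_eq_iff)
  have "0 \<le> x \<bullet> (W *v x)" for x
  proof -
    have "0 \<le> stack x 0 0 \<bullet> (?P *v stack x 0 0)"
      using assms unfolding pos_semidef_def by blast
    then show ?thesis
      by (simp add: cost_matrix_mult_stack inner_stack)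
  qed
  with sym show ?thesis by (simp add: pos_semidef_def)
qed

section \<open>Minimising a positive definite quadratic\<close>

lemma pos_def_invertible: "pos_def \<Lambda> \<Longrightarrow> invertible \<Lambda>"
  unfolding invertible_left_inverse matrix_left_invertible_ker pos_def_def
  by (metis inner_zero_right less_irrefl)

lemma pos_def_matrix_inv:
  assumes "pos_def \<Lambda>"
  shows "\<Lambda> *v (matrix_inv \<Lambda> *v b) = b" "transpose (matrix_inv \<Lambda>) = matrix_inv \<Lambda>"
proof -
  have inv: "\<Lambda> ** matrix_inv \<Lambda> = mat 1"
    using someI_ex[OF pos_def_invertible[OF assms, unfolded invertible_def]]
    unfolding matrix_inv_def by blast
  show "\<Lambda> *v (matrix_inv \<Lambda> *v b) = b" for b
    by (simp add: matrix_vector_mul_assoc inv)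
  have sym: "transpose \<Lambda> = \<Lambda>"
    using assms by (simp add: pos_def_def)
  have "transpose (matrix_inv \<Lambda>) ** \<Lambda> = mat 1"
    using arg_cong[OF inv, of transpose] by (simp add: matrix_transpose_mul sym)
  then show "transpose (matrix_inv \<Lambda>) = matrix_inv \<Lambda>"
    using inv matrix_mul_assoc[of "transpose (matrix_inv \<Lambda>)" \<Lambda> "matrix_inv \<Lambda>"] by simp
qed

text \<open>Completing the square: with \<open>v = \<Lambda>\<inverse> b\<close> the function equals
  \<open>(u + v) \<bullet> \<Lambda> (u + v) + k - b \<bullet> v\<close>. The infimum is attained, at \<open>u = - v\<close>, so it is a genuine
  minimum rather than a default value of an unbounded \<open>INF\<close>.\<close>

lemma INF_quadratic:
  assumes pd: "pos_def \<Lambda>"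
  shows "(INF u. u \<bullet> (\<Lambda> *v u) + 2 * (u \<bullet> b) + k) = k - b \<bullet> (matrix_inv \<Lambda> *v b)"
proof (rule cInf_eq_minimum)
  let ?v = "matrix_inv \<Lambda> *v b"
  have sym: "x \<bullet> (\<Lambda> *v y) = y \<bullet> (\<Lambda> *v x)" for x y
    using pd inner_transpose_right[of x \<Lambda> y] by (simp add: pos_def_def inner_commute)
  have square: "u \<bullet> (\<Lambda> *v u) + 2 * (u \<bullet> b) + k =
      (u + ?v) \<bullet> (\<Lambda> *v (u + ?v)) + (k - b \<bullet> ?v)" for u
    using sym[of ?v u] inner_commute[of b ?v]
    unfolding matrix_vector_right_distrib inner_add_left inner_add_right pos_def_matrix_inv(1)[OF pd]
    by linarith
  have attained: "k - b \<bullet> ?v = (- ?v) \<bullet> (\<Lambda> *v (- ?v)) + 2 * ((- ?v) \<bullet> b) + k"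
    by (subst square) simp
  show "k - b \<bullet> ?v \<in> range (\<lambda>u. u \<bullet> (\<Lambda> *v u) + 2 * (u \<bullet> b) + k)"
    by (rule range_eqI[where x="- ?v"]) (fact attained)
  fix y assume "y \<in> range (\<lambda>u. u \<bullet> (\<Lambda> *v u) + 2 * (u \<bullet> b) + k)"
  then obtain u where y: "y = u \<bullet> (\<Lambda> *v u) + 2 * (u \<bullet> b) + k" by blast
  have "0 \<le> z \<bullet> (\<Lambda> *v z)" for z
    using pd unfolding pos_def_def by (cases "z = 0") (auto intro: less_imp_le)
  then show "k - b \<bullet> ?v \<le> y" unfolding y square by simp
qed


section \<open>One Bellman step\<close>

text \<open>Half the Hessian in \<open>u\<close> of stage cost plus quadratic cost-to-go.\<close>

definition input_weight :: "real^'m^'n \<Rightarrow> real^'m^'m \<Rightarrow> real^'n^'n \<Rightarrow> real^'m^'m" where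
  "input_weight B R G = R + transpose B ** G ** B"

definition riccati_map ::
  "real^'n^'n \<Rightarrow> real^'m^'n \<Rightarrow> real^'n^'n \<Rightarrow> real^'m^'n \<Rightarrow> real^'m^'m \<Rightarrow> real^'n^'n \<Rightarrow> real^'n^'n" where
  "riccati_map A B W D R G = transpose A ** G ** A + W
     - (transpose A ** G ** B + D) ** matrix_inv (input_weight B R G) ** (transpose B ** G ** A + transpose D)"

lemma pos_def_input_weight:
  assumes "pos_def R" "pos_semidef G"
  shows "pos_def (input_weight B R G)"
proof -
  have "transpose (input_weight B R G) = input_weight B R G"
    using assms
    by (simp add: input_weight_def pos_def_def pos_semidef_def matrix_transpose_mul matrix_mul_assoc transpose_add)
  moreover have "0 < x \<bullet> (input_weight B R G *v x)" if "x \<noteq> 0" for x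
  proof -
    have "x \<bullet> (input_weight B R G *v x) = x \<bullet> (R *v x) + (B *v x) \<bullet> (G *v (B *v x))"
      by (simp add: input_weight_def matrix_vector_mult_add_rdistrib inner_add_right
          matrix_vector_mul_assoc[symmetric] inner_transpose_right)
    then show ?thesis
      using assms that by (simp add: pos_def_def pos_semidef_def add_pos_nonneg)
  qed
  ultimately show ?thesis by (simp add: pos_def_def)
qed

text \<open>The part of \<open>Q\<close> linear in \<open>u\<close> has coefficient \<open>b0 + e\<close>, where \<open>b0\<close> is linear in \<open>x\<close> and \<open>e\<close>
  collects the influence of environment and noise. The square \<open>(b0 + e) \<bullet> \<Lambda>\<inverse> (b0 + e)\<close> subtracted
  by the minimisation therefore splits: its \<open>b0\<close> part completes the Riccati map, its cross term is
  linear in \<open>x\<close>, and its \<open>e\<close> part is free of \<open>x\<close>. Keeping \<open>g\<close>, \<open>r\<close> and \<open>s\<close> arbitrary makes the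
  identity usable for the noise-free problem as well.\<close>

lemma bellman_quadratic:
  fixes B :: "real^'m^'n" and s :: "real^'p" and g :: "real^'n" and r :: real
  assumes P: "pos_semidef (cost_matrix W F D M H R)" and R: "pos_def R" and G: "pos_semidef G"
  defines "e \<equiv> transpose H *v s + transpose B *v g"
  shows "(INF u. quad_cost (cost_matrix W F D M H R) x s u
            + (A *v x + B *v u) \<bullet> (G *v (A *v x + B *v u)) + (2 * ((A *v x + B *v u) \<bullet> g) + r)) =
    x \<bullet> (riccati_map A B W D R G *v x)
    + 2 * (x \<bullet> (F *v s + transpose A *v g - (transpose A ** G ** B + D) *v (matrix_inv (input_weight B R G) *v e)))
    + (s \<bullet> (M *v s) + r - e \<bullet> (matrix_inv (input_weight B R G) *v e))"
proof -
  have W: "transpose W = W"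
    using pos_semidef_upper_left[OF P] by (simp add: pos_semidef_def)
  have symG: "a \<bullet> (G *v b) = b \<bullet> (G *v a)" for a b
    using G inner_transpose_right[of a G b] by (simp add: pos_semidef_def inner_commute)
  have pd: "pos_def (input_weight B R G)" using pos_def_input_weight[OF R G] .
  have symI: "a \<bullet> (matrix_inv (input_weight B R G) *v b) = b \<bullet> (matrix_inv (input_weight B R G) *v a)" for a b
    using pos_def_matrix_inv(2)[OF pd] inner_transpose_right[of a "matrix_inv (input_weight B R G)" b]
    by (simp add: inner_commute)
  define b0 where "b0 = transpose B *v (G *v (A *v x)) + transpose D *v x"
  define k where "k = x \<bullet> (W *v x) + 2 * (x \<bullet> (F *v s)) + s \<bullet> (M *v s)
      + (A *v x) \<bullet> (G *v (A *v x)) + 2 * ((A *v x) \<bullet> g) + r"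
  have expand: "quad_cost (cost_matrix W F D M H R) x s u
            + (A *v x + B *v u) \<bullet> (G *v (A *v x + B *v u)) + (2 * ((A *v x + B *v u) \<bullet> g) + r) =
       u \<bullet> (input_weight B R G *v u) + 2 * (u \<bullet> (b0 + e)) + k" for u
    unfolding quad_cost_cost_matrix[OF W] b0_def e_def k_def
    using symG[of "A *v x" "B *v u"] inner_commute[of x "D *v u"] inner_commute[of s "H *v u"]
    by (simp add: input_weight_def matrix_vector_mult_add_rdistrib matrix_vector_right_distrib inner_add_right
        inner_add_left matrix_vector_mul_assoc[symmetric] inner_transpose_right)
  have cross: "a \<bullet> ((transpose A ** G ** B + D) *v z) = (transpose B *v (G *v (A *v a)) + transpose D *v a) \<bullet> z" for a z
    by (simp add: matrix_vector_mult_add_rdistrib inner_add_right inner_add_left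
        matrix_vector_mul_assoc[symmetric] inner_transpose_right inner_transpose_left)
       (metis symG inner_commute)
  have "x \<bullet> (riccati_map A B W D R G *v x) = (A *v x) \<bullet> (G *v (A *v x)) + x \<bullet> (W *v x) - b0 \<bullet> (matrix_inv (input_weight B R G) *v b0)"
    by (simp add: riccati_map_def matrix_vector_mult_diff_rdistrib matrix_vector_mult_add_rdistrib[of "transpose A ** G ** A"]
        matrix_vector_mult_add_rdistrib[of "transpose B ** G ** A"]
        inner_diff_right inner_add_right matrix_vector_mul_assoc[symmetric] cross b0_def[symmetric])
       (simp add: inner_transpose_right)
  moreover have "(INF u. quad_cost (cost_matrix W F D M H R) x s u
            + (A *v x + B *v u) \<bullet> (G *v (A *v x + B *v u)) + (2 * ((A *v x + B *v u) \<bullet> g) + r)) =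
      k - (b0 + e) \<bullet> (matrix_inv (input_weight B R G) *v (b0 + e))"
    using INF_quadratic[OF pd, of "b0 + e" k] by (simp only: expand)
  moreover have "(b0 + e) \<bullet> (matrix_inv (input_weight B R G) *v (b0 + e)) =
      b0 \<bullet> (matrix_inv (input_weight B R G) *v b0) + 2 * (b0 \<bullet> (matrix_inv (input_weight B R G) *v e)) + e \<bullet> (matrix_inv (input_weight B R G) *v e)"
    unfolding matrix_vector_right_distrib inner_add_left inner_add_right using symI[of b0 e] by linarith
  moreover have "x \<bullet> (F *v s + transpose A *v g - (transpose A ** G ** B + D) *v (matrix_inv (input_weight B R G) *v e)) =
      x \<bullet> (F *v s) + (A *v x) \<bullet> g - b0 \<bullet> (matrix_inv (input_weight B R G) *v e)"
    unfolding inner_diff_right inner_add_right cross b0_def[symmetric] inner_transpose_right ..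
  ultimately show ?thesis
    unfolding k_def by argo
qed

text \<open>Nonnegativity comes from the variational meaning: the quadratic form of the Riccati map is an
  infimum of nonnegative costs.\<close>

lemma pos_semidef_riccati_map:
  assumes P: "pos_semidef (cost_matrix W F D M H R)" and R: "pos_def R" and G: "pos_semidef G"
  shows "pos_semidef (riccati_map A B W D R G)"
proof -
  have W: "transpose W = W"
    using pos_semidef_upper_left[OF P] by (simp add: pos_semidef_def)
  have symG: "transpose G = G" using G by (simp add: pos_semidef_def)
  have pd: "pos_def (input_weight B R G)" using pos_def_input_weight[OF R G] .
  have "transpose (riccati_map A B W D R G) = riccati_map A B W D R G"
    by (simp add: riccati_map_def transpose_add transpose_diff matrix_transpose_mul W symG pos_def_matrix_inv(2)[OF pd] matrix_mul_assoc)
  moreover have "0 \<le> x \<bullet> (riccati_map A B W D R G *v x)" for x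
  proof -
    have "0 \<le> (INF u. quad_cost (cost_matrix W F D M H R) x 0 u
            + (A *v x + B *v u) \<bullet> (G *v (A *v x + B *v u)) + (2 * ((A *v x + B *v u) \<bullet> 0) + 0))"
      using P G by (intro cINF_greatest) (auto simp: pos_semidef_def quad_cost_def)
    then show ?thesis unfolding bellman_quadratic[OF P R G] by simp
  qed
  ultimately show ?thesis by (simp add: pos_semidef_def)
qed

section \<open>Kernels that are linear in a feature map\<close>

text \<open>The coefficients may be negative, so the right-hand side is not the integral of a measure.
  Both sides are nevertheless linear in \<open>f\<close> and, for a uniformly bounded increasing sequence of
  functions, pass to the limit by dominated convergence; hence the identity extends from indicators
  to nonnegative bounded functions, and by splitting \<open>f\<close> into positive and negative part to all
  bounded ones.\<close>

lemma integral_linear_combination: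
  fixes N :: "'i \<Rightarrow> 'a measure" and f :: "'a \<Rightarrow> real"
  assumes "finite I" and M: "finite_measure M"
    and N: "\<And>i. i \<in> I \<Longrightarrow> finite_measure (N i)"
    and sets: "\<And>i. i \<in> I \<Longrightarrow> sets (N i) = sets M"
    and eq: "\<And>E. E \<in> sets M \<Longrightarrow> measure M E = (\<Sum>i\<in>I. c i * measure (N i) E)"
    and f: "f \<in> borel_measurable M" and bound: "\<And>x. x \<in> space M \<Longrightarrow> \<bar>f x\<bar> \<le> C"
  shows "integral\<^sup>L M f = (\<Sum>i\<in>I. c i * integral\<^sup>L (N i) f)"
proof -
  have space: "space (N i) = space M" if "i \<in> I" for i
    using sets_eq_imp_space_eq[OF sets[OF that]] .
  have meas: "g \<in> borel_measurable (N i) \<longleftrightarrow> g \<in> borel_measurable M" if "i \<in> I" for i and g :: "'a \<Rightarrow> real"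
    using measurable_cong_sets[OF sets[OF that] refl] by blast
  define bdd where "bdd g \<longleftrightarrow> (\<exists>C. \<forall>x\<in>space M. \<bar>g x\<bar> \<le> C)" for g :: "'a \<Rightarrow> real"
  have intM: "integrable M g" if "g \<in> borel_measurable M" "bdd g" for g
  proof -
    from that obtain C where "\<forall>x\<in>space M. \<bar>g x\<bar> \<le> C" by (auto simp: bdd_def)
    then show ?thesis
      using that(1) by (intro finite_measure.integrable_const_bound[OF M, of _ C]) auto
  qed
  have intN: "integrable (N i) g" if "i \<in> I" "g \<in> borel_measurable M" "bdd g" for i g
  proof -
    from that obtain C where "\<forall>x\<in>space M. \<bar>g x\<bar> \<le> C" by (auto simp: bdd_def)
    then show ?thesis
      using that by (intro finite_measure.integrable_const_bound[OF N, of _ _ C]) (auto simp: meas space)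
  qed
  have nonneg: "bdd g \<longrightarrow> integral\<^sup>L M g = (\<Sum>i\<in>I. c i * integral\<^sup>L (N i) g)"
    if "g \<in> borel_measurable M" "\<And>x. 0 \<le> g x" for g
    using that
  proof (induction rule: borel_measurable_induct_real)
    case (set E)
    have "integral\<^sup>L M (indicator E) = measure M E"
      using set sets.sets_into_space[OF set] by (simp add: Int_absorb2)
    moreover have "integral\<^sup>L (N i) (indicator E) = measure (N i) E" if "i \<in> I" for i
      using set sets.sets_into_space[OF set] by (simp add: Int_absorb2 space[OF that])
    ultimately show ?case using eq[OF set] by simp
  next
    case (mult u k)
    show ?case
    proof (cases "k = 0")
      case False
      have "bdd u" if bdd: "bdd (\<lambda>x. k * u x)"
      proof -
        from bdd obtain C where "\<forall>x\<in>space M. \<bar>k * u x\<bar> \<le> C" by (auto simp: bdd_def)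
        then have "\<forall>x\<in>space M. \<bar>u x\<bar> \<le> C / \<bar>k\<bar>"
          using False by (simp add: abs_mult pos_le_divide_eq mult.commute)
        then show ?thesis by (auto simp: bdd_def)
      qed
      then show ?thesis using mult by (auto simp: sum_distrib_left mult.left_commute)
    qed simp
  next
    case (add u v)
    show ?case
    proof
      assume "bdd (\<lambda>x. v x + u x)"
      then obtain C where C: "\<forall>x\<in>space M. \<bar>v x + u x\<bar> \<le> C" by (auto simp: bdd_def)
      have "\<bar>u x\<bar> \<le> C" "\<bar>v x\<bar> \<le> C" if "x \<in> space M" for x
        using C[rule_format, OF that] add(2)[of x] add(4)[of x] by linarith+
      then have "bdd u" "bdd v" by (auto simp: bdd_def)
      then show "(\<integral>x. v x + u x \<partial>M) = (\<Sum>i\<in>I. c i * (\<integral>x. v x + u x \<partial>N i))"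
        using add by (simp add: intM intN sum.distrib[symmetric] distrib_left)
    qed
  next
    case (seq U)
    show ?case
    proof
      assume "bdd g"
      then obtain C where C: "\<forall>x\<in>space M. \<bar>g x\<bar> \<le> C" by (auto simp: bdd_def)
      have le: "\<bar>U n x\<bar> \<le> C" if "x \<in> space M" for n x
      proof -
        have "incseq (\<lambda>n. U n x)" using seq(3) by (auto simp: incseq_def le_fun_def)
        then have "U n x \<le> g x" using incseq_le seq(4)[OF that] by blast
        then show ?thesis using C[rule_format, OF that] seq(2)[of n x] by linarith
      qed
      then have "bdd (U n)" for n by (auto simp: bdd_def)
      then have eqn: "integral\<^sup>L M (U n) = (\<Sum>i\<in>I. c i * integral\<^sup>L (N i) (U n))" for n
        using seq(5) by blast
      have limM: "(\<lambda>n. integral\<^sup>L M (U n)) \<longlonglongrightarrow> integral\<^sup>L M g"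
        using that seq le finite_measure.integrable_const[OF M]
        by (intro integral_dominated_convergence[where w="\<lambda>_. C"]) auto
      have limN: "(\<lambda>n. integral\<^sup>L (N i) (U n)) \<longlonglongrightarrow> integral\<^sup>L (N i) g" if i: "i \<in> I" for i
        using \<open>g \<in> borel_measurable M\<close> seq le finite_measure.integrable_const[OF N[OF i]]
        by (intro integral_dominated_convergence[where w="\<lambda>_. C"]) (auto simp: meas[OF i] space[OF i])
      have "(\<lambda>n. integral\<^sup>L M (U n)) \<longlonglongrightarrow> (\<Sum>i\<in>I. c i * integral\<^sup>L (N i) g)"
        unfolding eqn by (intro tendsto_intros limN)
      then show "integral\<^sup>L M g = (\<Sum>i\<in>I. c i * integral\<^sup>L (N i) g)"
        using limM LIMSEQ_unique by blast
    qed
  qed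
  define fp fm where "fp x = max 0 (f x)" and "fm x = max 0 (- f x)" for x
  have "fp \<in> borel_measurable M" "fm \<in> borel_measurable M"
    unfolding fp_def[abs_def] fm_def[abs_def] using f by measurable
  moreover have "bdd fp" "bdd fm"
    unfolding bdd_def fp_def fm_def using bound by (fastforce intro!: exI[of _ C] simp: max_def)+
  moreover have "f = (\<lambda>x. fp x - fm x)" by (auto simp: fp_def fm_def max_def)
  moreover have "integral\<^sup>L M fp = (\<Sum>i\<in>I. c i * integral\<^sup>L (N i) fp)"
    "integral\<^sup>L M fm = (\<Sum>i\<in>I. c i * integral\<^sup>L (N i) fm)"
    using calculation nonneg by (auto simp: fp_def fm_def)
  ultimately show ?thesis
    by (simp add: intM intN sum_subtractf[symmetric] right_diff_distrib)
qed

text \<open>Only the values of \<open>\<mu>\<close> on sets are used: they show that a linear relation among feature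
  vectors is inherited by the kernels. The vector \<open>v\<close> represents the linear functional that extends
  the values of the integral on a basis chosen inside the image of \<open>\<phi>\<close>.\<close>

lemma linear_kernel_integral:
  fixes \<phi> :: "'a \<Rightarrow> real^'d" and K :: "'a \<Rightarrow> 'a measure" and f :: "'a \<Rightarrow> real"
  assumes K: "K \<in> measurable N (prob_algebra N)"
    and lin: "\<And>s E. s \<in> space N \<Longrightarrow> E \<in> sets N \<Longrightarrow> measure (K s) E = \<phi> s \<bullet> \<mu> E"
    and f: "f \<in> borel_measurable N" and bound: "\<And>s. s \<in> space N \<Longrightarrow> \<bar>f s\<bar> \<le> C"
  shows "\<exists>v. \<forall>s\<in>space N. integral\<^sup>L (K s) f = \<phi> s \<bullet> v"
proof -
  have Ks: "prob_space (K s)" "sets (K s) = sets N" "space (K s) = space N" if "s \<in> space N" for s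
    using measurable_space[OF K that] sets_eq_imp_space_eq[of "K s" N] by (auto simp: space_prob_algebra)
  obtain b where b: "b \<subseteq> \<phi> ` space N" "independent b" "\<phi> ` space N \<subseteq> span b"
    using basis_exists[of "\<phi> ` space N"] by metis
  have "\<forall>v\<in>b. \<exists>s\<in>space N. \<phi> s = v" using b(1) by auto
  then obtain r where r: "\<And>v. v \<in> b \<Longrightarrow> r v \<in> space N \<and> \<phi> (r v) = v" by metis
  have fin: "finite b" using b(2) independent_imp_finite by blast
  obtain l :: "real^'d \<Rightarrow> real" where l: "linear l" "\<And>v. v \<in> b \<Longrightarrow> l v = integral\<^sup>L (K (r v)) f"
    using linear_independent_extend[OF b(2), of "\<lambda>v. integral\<^sup>L (K (r v)) f"] by auto
  have "integral\<^sup>L (K s) f = l (\<phi> s)" if s: "s \<in> space N" for s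
  proof -
    define c where "c = representation b (\<phi> s)"
    have phi: "\<phi> s = (\<Sum>v\<in>b. c v *\<^sub>R v)"
      using b s fin by (simp add: c_def sum_representation_eq image_subset_iff)
    have "integral\<^sup>L (K s) f = (\<Sum>v\<in>b. c v * integral\<^sup>L (K (r v)) f)"
    proof (rule integral_linear_combination[OF fin])
      fix E assume "E \<in> sets (K s)"
      then have E: "E \<in> sets N" using Ks s by simp
      have "measure (K s) E = (\<Sum>v\<in>b. c v * (v \<bullet> \<mu> E))"
        unfolding lin[OF s E] by (simp add: phi inner_sum_left)
      also have "\<dots> = (\<Sum>v\<in>b. c v * measure (K (r v)) E)"
        using lin[OF _ E] r by (intro sum.cong) auto
      finally show "measure (K s) E = (\<Sum>v\<in>b. c v * measure (K (r v)) E)" .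
    qed (use Ks s r f bound in \<open>auto simp: prob_space_def cong: measurable_cong_sets\<close>)
    also have "\<dots> = l (\<phi> s)"
      using l by (simp add: phi linear_sum linear_cmul)
    finally show ?thesis .
  qed
  moreover have "l x = x \<bullet> adjoint l 1" for x
    using adjoint_works[OF l(1), of x 1] by simp
  ultimately show ?thesis by metis
qed

lemma continuous_bounded_on_compact:
  fixes f :: "'a::metric_space \<Rightarrow> real"
  assumes "continuous_on UNIV f" "compact C"
  obtains c where "\<And>z. z \<in> C \<Longrightarrow> \<bar>f z\<bar> \<le> c"
proof -
  have "bounded (f ` C)"
    using assms by (meson compact_continuous_image compact_imp_bounded continuous_on_subset subset_UNIV)
  then obtain c where "\<And>z. z \<in> C \<Longrightarrow> norm (f z) \<le> c" unfolding bounded_iff by blast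
  with that show thesis by auto
qed

text \<open>Each coordinate of \<open>h\<close> and the scalar \<open>q\<close> contribute one vector of \<open>\<phi>\<close>-coefficients;
  regrouping these by the index of \<open>\<phi>\<close> instead of the index of the coordinate yields \<open>h'\<close> and
  \<open>q'\<close>. The quadratic term is unchanged since \<open>K s\<close> has total mass one.\<close>

lemma expected_value:
  fixes \<phi> :: "real^'p \<Rightarrow> real^'d" and K :: "real^'p \<Rightarrow> (real^'p) measure" and G :: "real^'n^'n"
    and h :: "(real^'p) \<times> (real^'d) \<Rightarrow> real^'n" and q :: "(real^'p) \<times> (real^'d) \<Rightarrow> real"
  assumes K: "K \<in> measurable (restrict_space borel S) (prob_algebra (restrict_space borel S))"
    and lin: "\<And>s E. s \<in> S \<Longrightarrow> E \<in> sets (restrict_space borel S) \<Longrightarrow> measure (K s) E = \<phi> s \<bullet> \<mu> E"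
    and phi_meas: "\<phi> \<in> borel_measurable (restrict_space borel S)"
    and phi_bound: "\<And>s. s \<in> S \<Longrightarrow> norm (\<phi> s) \<le> a"
    and S_bound: "\<And>s. s \<in> S \<Longrightarrow> norm s \<le> b"
    and cont: "continuous_on UNIV h" "continuous_on UNIV q"
    and v: "\<And>y s. s \<in> S \<Longrightarrow> v y s = y \<bullet> (G *v y) + 2 * (y \<bullet> h (s, \<phi> s)) + q (s, \<phi> s)"
  shows "\<exists>(h' :: 'd \<Rightarrow> real^'n) q'. \<forall>y. \<forall>s\<in>S. (\<integral>s'. v y s' \<partial>K s) =
    y \<bullet> (G *v y) + (\<Sum>i\<in>UNIV. \<phi> s $ i * (2 * (y \<bullet> h' i) + q' i))"
proof -
  let ?N = "restrict_space borel S :: (real^'p) measure"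
  have space: "space ?N = S" by (simp add: space_restrict_space)
  have Ks: "prob_space (K s)" "sets (K s) = sets ?N" "space (K s) = S" if "s \<in> S" for s
    using measurable_space[OF K, of s] that space
    by (auto simp: space_prob_algebra dest: sets_eq_imp_space_eq)
  have meas: "(\<lambda>s. f (s, \<phi> s)) \<in> borel_measurable ?N" if "continuous_on UNIV f" for f :: "_ \<Rightarrow> real"
  proof -
    have "f \<in> borel_measurable borel" using that by (rule borel_measurable_continuous_onI)
    moreover have "(\<lambda>s. (s, \<phi> s)) \<in> borel_measurable ?N"
      using phi_meas by (intro borel_measurable_Pair) (auto intro: measurable_restrict_space1)
    ultimately show ?thesis by (rule measurable_compose[rotated])
  qed
  have bdd: "\<exists>c. \<forall>s\<in>S. \<bar>f (s, \<phi> s)\<bar> \<le> c" if f: "continuous_on UNIV f" for f :: "_ \<Rightarrow> real"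
  proof -
    obtain c where "\<And>z. z \<in> cball 0 b \<times> cball 0 a \<Longrightarrow> \<bar>f z\<bar> \<le> c"
      using continuous_bounded_on_compact[OF f compact_Times[OF compact_cball compact_cball]] by blast
    then show ?thesis using phi_bound S_bound by (intro exI[of _ c]) auto
  qed
  have int: "integrable (K s) (\<lambda>s. f (s, \<phi> s))" if s: "s \<in> S" and f: "continuous_on UNIV f" for s and f :: "_ \<Rightarrow> real"
  proof -
    interpret prob_space "K s" using Ks(1)[OF s] .
    obtain c where c: "\<forall>s\<in>S. \<bar>f (s, \<phi> s)\<bar> \<le> c" using bdd[OF f] by blast
    have "(\<lambda>s. f (s, \<phi> s)) \<in> borel_measurable (K s)"
      using meas[OF f] measurable_cong_sets[OF Ks(2)[OF s] refl] by blast
    then show ?thesis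
      using c Ks(3)[OF s] by (intro integrable_const_bound[of _ c]) auto
  qed
  have lin_int: "\<exists>w. \<forall>s\<in>S. (\<integral>s'. f (s', \<phi> s') \<partial>K s) = \<phi> s \<bullet> w"
    if f: "continuous_on UNIV f" for f :: "_ \<Rightarrow> real"
  proof -
    obtain c where c: "\<forall>s\<in>S. \<bar>f (s, \<phi> s)\<bar> \<le> c" using bdd[OF f] by blast
    show ?thesis
      using linear_kernel_integral[OF K, of \<phi> \<mu>, OF _ meas[OF f], of c] lin c by (simp add: space)
  qed
  have cont_h: "continuous_on UNIV (\<lambda>z. h z $ j)" for j
    using cont(1) by (rule continuous_on_component)
  obtain w where w: "\<And>j s. s \<in> S \<Longrightarrow> (\<integral>s'. h (s', \<phi> s') $ j \<partial>K s) = \<phi> s \<bullet> w j"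
    using lin_int[OF cont_h] by metis
  obtain w' where w': "\<And>s. s \<in> S \<Longrightarrow> (\<integral>s'. q (s', \<phi> s') \<partial>K s) = \<phi> s \<bullet> w'"
    using lin_int[OF cont(2)] by metis
  have "(\<integral>s'. v y s' \<partial>K s) =
    y \<bullet> (G *v y) + (\<Sum>i\<in>UNIV. \<phi> s $ i * (2 * (y \<bullet> (\<chi> j. w j $ i)) + w' $ i))" if s: "s \<in> S" for y s
  proof -
    interpret prob_space "K s" using Ks(1)[OF s] .
    have "(\<integral>s'. v y s' \<partial>K s) =
        (\<integral>s'. y \<bullet> (G *v y) + 2 * (\<Sum>j\<in>UNIV. y $ j * h (s', \<phi> s') $ j) + q (s', \<phi> s') \<partial>K s)"
      by (intro Bochner_Integration.integral_cong refl) (simp add: v Ks(3)[OF s] inner_vec_def)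
    also have "\<dots> = y \<bullet> (G *v y) + 2 * (\<Sum>j\<in>UNIV. y $ j * (\<phi> s \<bullet> w j)) + \<phi> s \<bullet> w'"
      using int[OF s cont_h] int[OF s cont(2)] by (simp add: w[OF s] w'[OF s] prob_space)
    also have "(\<Sum>j\<in>UNIV. y $ j * (\<phi> s \<bullet> w j)) = (\<Sum>i\<in>UNIV. \<phi> s $ i * (y \<bullet> (\<chi> j. w j $ i)))"
      unfolding inner_vec_def sum_distrib_left by (subst sum.swap) (simp add: mult.left_commute)
    finally show ?thesis
      by (simp add: distrib_left sum.distrib sum_distrib_left mult.left_commute inner_vec_def[of "\<phi> s" w'])
  qed
  then show ?thesis by (intro exI[of _ "\<lambda>i. \<chi> j. w j $ i"] exI[of _ "\<lambda>i. w' $ i"]) blast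
qed

section \<open>The optimal state-action value functions\<close>

theorem mainTheorem1:
  fixes T :: nat
    and A :: "real^'n^'n" and B :: "real^'m^'n"
    and \<Omega> :: "'w measure" and x0 :: "'w \<Rightarrow> real^'n" and \<Sigma>x :: "real^'n^'n"
    and S :: "(real^'p) set" and \<mu>0 :: "(real^'p) measure"
    and K :: "nat \<Rightarrow> real^'p \<Rightarrow> (real^'p) measure" and \<xi> :: "nat \<Rightarrow> 'w \<Rightarrow> real^'p"
    and \<phi> :: "real^'p \<Rightarrow> real^'d" and \<mu> :: "nat \<Rightarrow> (real^'p) set \<Rightarrow> real^'d" and \<delta>s :: real
    and W :: "real^'n^'n" and F :: "real^'p^'n" and D :: "real^'m^'n"
    and M :: "real^'p^'p" and H :: "real^'m^'p" and R :: "real^'m^'m"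
    and P :: "real^('n + 'p + 'm)^('n + 'p + 'm)" and G :: "nat \<Rightarrow> real^'n^'n"
  assumes horizon: "1 \<le> T"
    and prob: "prob_space \<Omega>"
    and initial_state: "pos_def \<Sigma>x" "distributed \<Omega> lborel x0 (\<lambda>x. ennreal (gaussian_density \<Sigma>x x))"
    and ctrl: "controllable A B"
    and env: "markov_environment \<Omega> (restrict_space borel S) x0 \<mu>0 K T \<xi>"
    and phi_meas: "\<phi> \<in> borel_measurable (restrict_space borel S)"
    and signed: "\<And>t i. t < T \<Longrightarrow> finite_signed_measure (restrict_space borel S) (\<lambda>E. \<mu> t E $ i)"
    and linear: "\<And>t s E. t < T \<Longrightarrow> s \<in> S \<Longrightarrow> E \<in> sets (restrict_space borel S) \<Longrightarrow>
          measure (K t s) E = \<phi> s \<bullet> \<mu> t E"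
    and phi_bound: "\<And>s. s \<in> S \<Longrightarrow> norm (\<phi> s) \<le> 1 / sqrt (real CARD('d))"
    and S_bound: "\<And>s. s \<in> S \<Longrightarrow> norm s \<le> \<delta>s"
    and excitation: "\<And>t. t < T \<Longrightarrow>
          pos_def (\<chi> i j. prob_space.expectation \<Omega> (\<lambda>w. \<phi> (\<xi> t w) $ i * \<phi> (\<xi> t w) $ j))"
    and cost: "P = cost_matrix W F D M H R" "pos_semidef P" "pos_def R"
    and obs: "observable A (mat_sqrt W)"
    and riccati_terminal: "G T = W"
    and riccati: "\<And>t. t < T \<Longrightarrow> G t =
          transpose A ** G (Suc t) ** A + W
          - (transpose A ** G (Suc t) ** B + D)
            ** matrix_inv (R + transpose B ** G (Suc t) ** B)
            ** (transpose B ** G (Suc t) ** A + transpose D)"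
  shows "\<forall>t<T. \<exists>(h :: 'd \<Rightarrow> real^'n) (q :: 'd \<Rightarrow> real). \<forall>x. \<forall>s\<in>S. \<forall>u.
           opt_Q (quad_cost P) A B K T t x s u =
             quad_cost P x s u
             + (A *v x + B *v u) \<bullet> (G (Suc t) *v (A *v x + B *v u))
             + (\<Sum>i\<in>UNIV. \<phi> s $ i * (2 * ((A *v x + B *v u) \<bullet> h i) + q i))"
proof -
  have K: "K t \<in> measurable (restrict_space borel S) (prob_algebra (restrict_space borel S))" if "t < T" for t
    using env that by (simp add: markov_environment_def)
  define quad where "quad t \<longleftrightarrow> (\<exists>h q. continuous_on UNIV h \<and> continuous_on UNIV q \<and>
    (\<forall>x. \<forall>s\<in>S. opt_V (quad_cost P) A B K T t x s =
       x \<bullet> (G t *v x) + 2 * (x \<bullet> h (s, \<phi> s)) + q (s, \<phi> s)))" for t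
  have Q_form: "\<exists>(h :: 'd \<Rightarrow> real^'n) (q :: 'd \<Rightarrow> real). \<forall>x. \<forall>s\<in>S. \<forall>u.
           opt_Q (quad_cost P) A B K T t x s u =
             quad_cost P x s u
             + (A *v x + B *v u) \<bullet> (G (Suc t) *v (A *v x + B *v u))
             + (\<Sum>i\<in>UNIV. \<phi> s $ i * (2 * ((A *v x + B *v u) \<bullet> h i) + q i))"
    if t: "t < T" and IH: "quad (Suc t)" for t
  proof -
    obtain h q where hq: "continuous_on UNIV h" "continuous_on UNIV q"
      "\<And>x s. s \<in> S \<Longrightarrow> opt_V (quad_cost P) A B K T (Suc t) x s =
         x \<bullet> (G (Suc t) *v x) + 2 * (x \<bullet> h (s, \<phi> s)) + q (s, \<phi> s)"
      using IH unfolding quad_def by blast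
    obtain h' q' where "\<And>y s. s \<in> S \<Longrightarrow> (\<integral>s'. opt_V (quad_cost P) A B K T (Suc t) y s' \<partial>K t s) =
        y \<bullet> (G (Suc t) *v y) + (\<Sum>i\<in>UNIV. \<phi> s $ i * (2 * (y \<bullet> h' i) + q' i))"
      using expected_value[OF K[OF t] linear[OF t] phi_meas phi_bound S_bound hq] t by blast
    then show ?thesis
      unfolding opt_Q_def by (intro exI[of _ h'] exI[of _ q']) (simp only: add.assoc ball_simps simp_thms, simp)
  qed
  note mv_cont = bounded_linear.continuous_on[OF matrix_vector_mul_bounded_linear]
  have P: "pos_semidef (cost_matrix W F D M H R)" using cost by simp
  have V_form: "pos_semidef (G t) \<and> quad t" if "t \<le> T" for t
    using that
  proof (induction rule: inc_induct)
    case base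
    have W: "pos_semidef W" using pos_semidef_upper_left[OF P] .
    let ?h = "\<lambda>(s, z :: real^'d). F *v s" and ?q = "\<lambda>(s, z :: real^'d). s \<bullet> (M *v s)"
    have "opt_V (quad_cost P) A B K T T x s = x \<bullet> (G T *v x) + 2 * (x \<bullet> ?h (s, \<phi> s)) + ?q (s, \<phi> s)" for x s
      unfolding opt_V_terminal cost(1) riccati_terminal
      using W by (simp add: quad_cost_cost_matrix pos_semidef_def)
    moreover have "continuous_on UNIV ?h" "continuous_on UNIV ?q"
      unfolding split_beta by (intro continuous_intros mv_cont)+
    ultimately have "quad T" unfolding quad_def by blast
    then show ?case using W by (simp add: riccati_terminal)
  next
    case (step t)
    then have t: "t < T" and G: "pos_semidef (G (Suc t))" by auto
    have G_step: "G t = riccati_map A B W D R (G (Suc t))"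
      unfolding riccati_map_def input_weight_def using riccati[OF t] .
    obtain h q where hq: "\<And>x s u. s \<in> S \<Longrightarrow> opt_Q (quad_cost P) A B K T t x s u =
             quad_cost P x s u
             + (A *v x + B *v u) \<bullet> (G (Suc t) *v (A *v x + B *v u))
             + (\<Sum>i\<in>UNIV. \<phi> s $ i * (2 * ((A *v x + B *v u) \<bullet> h i) + q i))"
      using Q_form[OF t] step by blast
    \<comment> \<open>The noise terms enter as one vector and one scalar, both linear in \<open>z = \<phi> s\<close>.\<close>
    define g where "g z = (\<Sum>i\<in>UNIV. z $ i *\<^sub>R h i)" for z :: "real^'d"
    define r where "r z = (\<Sum>i\<in>UNIV. z $ i * q i)" for z :: "real^'d"
    define L where "L = matrix_inv (input_weight B R (G (Suc t)))"
    define e where "e s z = transpose H *v s + transpose B *v g z" for s z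
    define h' where "h' = (\<lambda>(s, z). F *v s + transpose A *v g z
        - (transpose A ** G (Suc t) ** B + D) *v (L *v e s z))"
    define q' where "q' = (\<lambda>(s, z). s \<bullet> (M *v s) + r z - e s z \<bullet> (L *v e s z))"
    have "opt_V (quad_cost P) A B K T t x s = x \<bullet> (G t *v x) + 2 * (x \<bullet> h' (s, \<phi> s)) + q' (s, \<phi> s)"
      if s: "s \<in> S" for x s
    proof -
      have noise: "(\<Sum>i\<in>UNIV. \<phi> s $ i * (2 * (y \<bullet> h i) + q i)) = 2 * (y \<bullet> g (\<phi> s)) + r (\<phi> s)" for y
        by (simp add: g_def r_def distrib_left sum.distrib inner_sum_right sum_distrib_left mult.left_commute)
      have "opt_V (quad_cost P) A B K T t x s = (INF u. quad_cost (cost_matrix W F D M H R) x s u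
            + (A *v x + B *v u) \<bullet> (G (Suc t) *v (A *v x + B *v u))
            + (2 * ((A *v x + B *v u) \<bullet> g (\<phi> s)) + r (\<phi> s)))"
        unfolding opt_V_step[OF t] by (rule INF_cong) (simp_all only: hq[OF s] noise cost(1)[symmetric])
      then show ?thesis
        unfolding bellman_quadratic[OF P cost(3) G] h'_def q'_def L_def e_def G_step prod.case .
    qed
    moreover have "continuous_on UNIV h'" "continuous_on UNIV q'"
      unfolding h'_def q'_def e_def g_def r_def split_beta by (intro continuous_intros mv_cont)+
    ultimately have "quad t" unfolding quad_def by blast
    moreover have "pos_semidef (G t)"
      unfolding G_step using pos_semidef_riccati_map[OF P cost(3) G] .
    ultimately show ?case by blast
  qed
  show ?thesis
    using Q_form V_form[OF Suc_leI] by blast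
qed

end
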